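(* Let $n>2$, let $A,B\in\mathbb{S}^n$, and consider the following relaxation of the quadratic assignment problem: $$\begin{aligned}\min\ & \langle B\otimes A, Y\rangle\\ \text{s.t. } & \langle I_n\otimes E_{jj},Y\rangle = 1 \text{ for } j=1,\ldots,n,\\ & \langle E_{jj}\otimes I_n,Y\rangle = 1 \text{ for } j=1,\ldots,n,\\ & \langle I_n\otimes(J_n-I_n)+(J_n-I_n)\otimes I_n, Y\rangle = 0,\\ & \langle J_{n^2},Y\rangle = n^2,\\ & Y\in\mathcal{D}^{n^2}.\end{aligned}$$ Let $S\subset\mathbb{S}^{n^2}$ be any admissible subspace for this problem, with orthogonal projection $P_S$ onto $S$. If $S$ contains the identity matrix or $P_S(\mathcal{N}^{n^2})\subseteq\mathcal{N}^{n^2}$, then $S$ has a basis of entrywise nonnegative matrices with pairwise disjoint supports. If both $P_S(\mathbb{S}^{n^2}_+)\subseteq\mathbb{S}^{n^2}_+$ and $S$ is unital, then $S$ is a Jordan configuration.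
   Context: $\mathbb{S}^k$ is the space of real symmetric $k\times k$ matrices with the trace inner product $\langle X,Y\rangle=\mathrm{trace}(XY)$; $\mathbb{S}^k_+$ is the cone of positive semidefinite matrices; $\mathcal{N}^k=\mathbb{S}^k\cap\mathbb{R}^{k\times k}_+$; $\mathcal{D}^k=\mathbb{S}^k_+\cap\mathbb{R}^{k\times k}_+$ is the doubly nonnegative cone. $I_k$ and $J_k$ are the $k\times k$ identity and all-ones matrices, $E_{jj}$ is the $n\times n$ matrix with a single $1$ in position $(j,j)$ and zeros elsewhere, and $\otimes$ is the Kronecker product. The support of a matrix is the set of positions of its nonzero entries. Admissibility: let $\{A_i\}$ be the set of constraint matrices $J_{n^2}$, $I_n\otimes(J_n-I_n)+(J_n-I_n)\otimes I_n$, $I_n\otimes E_{jj}$ and $E_{jj}\otimes I_n$ ($j=1,\ldots,n$), let $\mathcal{L}=\{X\in\mathbb{S}^{n^2}:\langle A_i,X\rangle=0\ \forall i\}$, let $X_0=\mathrm{vec}(I_n)\mathrm{vec}(I_n)^T$ (a feasible solution, so the affine constraints read $Y\in X_0+\mathcal{L}$), and let $C=B\otimes A$. A linear subspace $S\subseteq\mathbb{S}^{n^2}$ with orthogonal projection $P_S$ is admissible if: (i) $P_S(\mathcal{D}^{n^2})\subseteq\mathcal{D}^{n^2}$; (ii) $P_S(X_0+\mathcal{L})\subseteq X_0+\mathcal{L}$; (iii) $P_S(C+\mathcal{L}^\perp)\subseteq C+\mathcal{L}^\perp$. The Jordan product on $\mathbb{S}^k$ is $X\circ Y=\frac12(XY+YX)$.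 A subspace $S$ is unital if there is an element $e\in S$ with $e\circ a=a\circ e=a$ for all $a\in S$. A partition of $[k]\times[k]$ with set of characteristic $0/1$ matrices $\mathcal{B}$ is called a Jordan configuration if: $X=X^T$ for all $X\in\mathcal{B}$; $XY+YX\in\mathrm{span}\,\mathcal{B}$ for all $X,Y\in\mathcal{B}$; and the identity matrix lies in $\mathrm{span}\,\mathcal{B}$. A subspace $S\subseteq \mathbb{S}^k$ is said to be a Jordan configuration if $S=\mathrm{span}\,\mathcal{B}$ where $\mathcal{B}$ is the set of characteristic matrices of a partition that is a Jordan configuration. *)

theory Defs
  imports "HOL-Analysis.Analysis"
begin

text \<open>Square matrices are indexed by finite types: $k \times k$ matrices have type
  \<open>real^'k^'k\<close>, and for $k = n^2$ the index type is \<open>'n \<times> 'n\<close>.  A pair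
  $(i,j)$ stands for the position $(i-1)n+j$, so its first component selects the block.\<close>


section \<open>Symmetric matrices\<close>

definition sym_mats :: "(real^'k^'k) set" where
  "sym_mats = {X. transpose X = X}"

definition trace_inner :: "real^'k^'k \<Rightarrow> real^'k^'k \<Rightarrow> real" where
  "trace_inner X Y = trace (X ** Y)"

definition psd_cone :: "(real^'k^'k) set" where
  "psd_cone = {X \<in> sym_mats. \<forall>v. 0 \<le> v \<bullet> (X *v v)}"

definition entrywise_nonneg :: "real^'k^'k \<Rightarrow> bool" where
  "entrywise_nonneg X \<longleftrightarrow> (\<forall>i j. 0 \<le> X $ i $ j)"

definition nonneg_cone :: "(real^'k^'k) set" where
  "nonneg_cone = {X \<in> sym_mats. entrywise_nonneg X}"

definition dnn_cone :: "(real^'k^'k) set" where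
  "dnn_cone = {X \<in> psd_cone. entrywise_nonneg X}"

definition supp :: "real^'k^'k \<Rightarrow> ('k \<times> 'k) set" where
  "supp X = {(i, j). X $ i $ j \<noteq> 0}"

definition sym_ortho :: "(real^'k^'k) set \<Rightarrow> (real^'k^'k) set" where
  "sym_ortho L = {X \<in> sym_mats. \<forall>Y \<in> L. trace_inner X Y = 0}"

text \<open>Only meaningful for a subspace \<open>S \<subseteq> sym_mats\<close> and \<open>X \<in> sym_mats\<close>; see
  \<open>orth_proj_eqI\<close> and \<open>orth_proj\<close> below.\<close>

definition orth_proj :: "(real^'k^'k) set \<Rightarrow> real^'k^'k \<Rightarrow> real^'k^'k" where
  "orth_proj S X = (THE Y. Y \<in> S \<and> (\<forall>Z \<in> S. trace_inner (X - Y) Z = 0))"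

lemma trace_inner_sym_mats:
  assumes "Y \<in> sym_mats"
  shows "trace_inner X Y = X \<bullet> Y"
proof -
  have "Y $ j $ i = Y $ i $ j" for i j
    using assms by (auto simp: sym_mats_def transpose_def vec_eq_iff)
  then show ?thesis
    by (simp add: trace_inner_def trace_def matrix_matrix_mult_def inner_vec_def)
qed

lemma orth_proj_eqI:
  assumes "subspace S" "S \<subseteq> sym_mats" "Y \<in> S" "\<And>Z. Z \<in> S \<Longrightarrow> trace_inner (X - Y) Z = 0"
  shows "orth_proj S X = Y"
  unfolding orth_proj_def
proof (rule the_equality)
  show "Y \<in> S \<and> (\<forall>Z \<in> S. trace_inner (X - Y) Z = 0)"
    using assms by blast
next
  fix W assume W: "W \<in> S \<and> (\<forall>Z \<in> S. trace_inner (X - W) Z = 0)"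
  have D: "W - Y \<in> S"
    using W assms by (simp add: subspace_diff)
  have "(X - Y) \<bullet> (W - Y) = 0" "(X - W) \<bullet> (W - Y) = 0"
    using D W assms trace_inner_sym_mats by (metis subsetD)+
  then have "(W - Y) \<bullet> (W - Y) = 0"
    by (simp add: inner_diff_left)
  then show "W = Y"
    by simp
qed

lemma orth_proj:
  assumes "subspace S" "S \<subseteq> sym_mats"
  shows "orth_proj S X \<in> S" "\<And>Z. Z \<in> S \<Longrightarrow> trace_inner (X - orth_proj S X) Z = 0"
proof -
  obtain Y W where "Y \<in> span S" "\<And>Z. Z \<in> span S \<Longrightarrow> orthogonal W Z" "X = Y + W"
    using orthogonal_subspace_decomp_exists[of S X] by metis
  then have Y: "Y \<in> S" "\<And>Z. Z \<in> S \<Longrightarrow> trace_inner (X - Y) Z = 0"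
    using assms by (auto simp: orthogonal_def span_eq_iff[THEN iffD2] trace_inner_sym_mats subsetD)
  then have "orth_proj S X = Y"
    using assms by (intro orth_proj_eqI)
  with Y show "orth_proj S X \<in> S" "\<And>Z. Z \<in> S \<Longrightarrow> trace_inner (X - orth_proj S X) Z = 0"
    by simp_all
qed


section \<open>Jordan product and Jordan configurations\<close>

definition jordan_prod :: "real^'k^'k \<Rightarrow> real^'k^'k \<Rightarrow> real^'k^'k" where
  "jordan_prod X Y = (1/2) *\<^sub>R (X ** Y + Y ** X)"

definition unital :: "(real^'k^'k) set \<Rightarrow> bool" where
  "unital S \<longleftrightarrow> (\<exists>e \<in> S. \<forall>a \<in> S. jordan_prod e a = a \<and> jordan_prod a e = a)"

definition char_mat :: "('k \<times> 'k) set \<Rightarrow> real^'k^'k" where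
  "char_mat p = (\<chi> i j. if (i, j) \<in> p then 1 else 0)"

definition jordan_partition :: "('k::finite \<times> 'k) set set \<Rightarrow> bool" where
  "jordan_partition P \<longleftrightarrow>
     partition_on UNIV P \<and>
     (\<forall>X \<in> char_mat ` P. transpose X = X) \<and>
     (\<forall>X \<in> char_mat ` P. \<forall>Y \<in> char_mat ` P. X ** Y + Y ** X \<in> span (char_mat ` P)) \<and>
     mat 1 \<in> span (char_mat ` P)"

definition jordan_configuration :: "(real^'k^'k) set \<Rightarrow> bool" where
  "jordan_configuration S \<longleftrightarrow> (\<exists>P. jordan_partition P \<and> S = span (char_mat ` P))"


section \<open>Admissible subspaces\<close>

text \<open>A doubly nonnegative program
  $\min \langle C, Y\rangle$ subject to $\langle M, Y\rangle = b$ for $(M,b) \in K$ and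
  $Y \in \mathcal{D}^k$ is given by its cost matrix $C$ and the set $K$ of its constraints.\<close>

definition affine_feasible :: "((real^'k^'k) \<times> real) set \<Rightarrow> (real^'k^'k) set" where
  "affine_feasible K = {Y \<in> sym_mats. \<forall>(M, b) \<in> K. trace_inner M Y = b}"

definition feasible :: "((real^'k^'k) \<times> real) set \<Rightarrow> (real^'k^'k) set" where
  "feasible K = affine_feasible K \<inter> dnn_cone"

definition constr_space :: "((real^'k^'k) \<times> real) set \<Rightarrow> (real^'k^'k) set" where
  "constr_space K = {X \<in> sym_mats. \<forall>(M, b) \<in> K. trace_inner M X = 0}"

definition admissible ::
  "((real^'k^'k) \<times> real) set \<Rightarrow> real^'k^'k \<Rightarrow> real^'k^'k \<Rightarrow> (real^'k^'k) set \<Rightarrow> bool" where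
  "admissible K X0 C S \<longleftrightarrow>
     subspace S \<and> S \<subseteq> sym_mats \<and>
     orth_proj S ` dnn_cone \<subseteq> dnn_cone \<and>
     orth_proj S ` ((+) X0 ` constr_space K) \<subseteq> (+) X0 ` constr_space K \<and>
     orth_proj S ` ((+) C ` sym_ortho (constr_space K)) \<subseteq> (+) C ` sym_ortho (constr_space K)"

lemma affine_feasible_eq_translate:
  assumes "X0 \<in> affine_feasible K"
  shows "affine_feasible K = (+) X0 ` constr_space K"
proof -
  have "Y \<in> affine_feasible K \<longleftrightarrow> Y - X0 \<in> constr_space K" for Y
  proof -
    have [simp]: "trace_inner M (Y - X0) = trace_inner M Y - trace_inner M X0" for M
      by (simp add: trace_inner_def trace_def matrix_matrix_mult_def right_diff_distrib
          sum_subtractf)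
    show ?thesis
      using assms
      by (fastforce simp: affine_feasible_def constr_space_def sym_mats_def transpose_def
          vec_eq_iff)
  qed
  moreover have "Y \<in> (+) X0 ` V \<longleftrightarrow> Y - X0 \<in> V" for Y and V :: "(real^'a^'a) set"
    by (auto simp: image_iff intro: bexI[of _ "Y - X0"])
  ultimately show ?thesis
    by blast
qed


section \<open>The relaxation of the quadratic assignment problem\<close>

definition kron :: "real^'a^'a \<Rightarrow> real^'b^'b \<Rightarrow> real^('a::finite \<times> 'b::finite)^('a \<times> 'b)"
    (infixl \<open>\<otimes>\<^sub>K\<close> 75) where
  "X \<otimes>\<^sub>K Y = (\<chi> p q. X $ fst p $ fst q * Y $ snd p $ snd q)"

definition all_ones :: "real^'k^'k" where
  "all_ones = (\<chi> i j. 1)"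

definition diag_unit :: "'k \<Rightarrow> real^'k^'k" where
  "diag_unit l = (\<chi> i j. if i = l \<and> j = l then 1 else 0)"

text \<open>Column-stacking vectorisation.\<close>

definition vec_mat :: "real^'n^'n \<Rightarrow> real^('n::finite \<times> 'n)" where
  "vec_mat X = (\<chi> p. X $ snd p $ fst p)"

definition qap_constraints :: "((real^('n::finite \<times> 'n)^('n \<times> 'n)) \<times> real) set" where
  "qap_constraints =
     range (\<lambda>j. (mat 1 \<otimes>\<^sub>K diag_unit j, 1)) \<union>
     range (\<lambda>j. (diag_unit j \<otimes>\<^sub>K mat 1, 1)) \<union>
     {(mat 1 \<otimes>\<^sub>K (all_ones - mat 1) + (all_ones - mat 1) \<otimes>\<^sub>K mat 1, 0),
      (all_ones, real (CARD('n)\<^sup>2))}"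

definition qap_cost :: "real^'n^'n \<Rightarrow> real^'n^'n \<Rightarrow> real^('n::finite \<times> 'n)^('n \<times> 'n)" where
  "qap_cost A B = B \<otimes>\<^sub>K A"

definition qap_X0 :: "real^('n::finite \<times> 'n)^('n \<times> 'n)" where
  "qap_X0 = (\<chi> p q. vec_mat (mat 1) $ p * vec_mat (mat 1) $ q)"

lemma qap_X0_feasible:
  "(qap_X0 :: real^('n::finite \<times> 'n)^('n \<times> 'n)) \<in> feasible qap_constraints"
proof -
  define v :: "real^('n \<times> 'n)" where "v = vec_mat (mat 1)"
  have X0: "(qap_X0 :: real^('n \<times> 'n)^('n \<times> 'n)) $ p $ q = v $ p * v $ q" for p q
    by (simp add: qap_X0_def v_def)
  have v: "v $ p = (if fst p = snd p then 1 else 0)" for p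
    by (auto simp: v_def vec_mat_def mat_def)
  have sum_v: "(\<Sum>p\<in>UNIV. f p * v $ p) = (\<Sum>i\<in>UNIV. f (i, i))" for f
  proof -
    have "(\<Sum>p\<in>UNIV. f p * v $ p) = (\<Sum>i\<in>UNIV. \<Sum>j\<in>UNIV. f (i, j) * v $ (i, j))"
      by (simp add: sum.cartesian_product)
    also have "\<dots> = (\<Sum>i\<in>UNIV. \<Sum>j\<in>UNIV. if i = j then f (i, j) else 0)"
      by (intro sum.cong) (auto simp: v)
    also have "\<dots> = (\<Sum>i\<in>UNIV. f (i, i))"
      by simp
    finally show ?thesis .
  qed
  have X0_inner: "trace_inner M qap_X0 = (\<Sum>i\<in>UNIV. \<Sum>k\<in>UNIV. M $ (i, i) $ (k, k))"
    for M :: "real^('n \<times> 'n)^('n \<times> 'n)"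
  proof -
    have "trace_inner M qap_X0 = (\<Sum>p\<in>UNIV. \<Sum>q\<in>UNIV. M $ p $ q * (v $ q * v $ p))"
      by (simp add: trace_inner_def trace_def matrix_matrix_mult_def X0)
    also have "\<dots> = (\<Sum>p\<in>UNIV. (\<Sum>q\<in>UNIV. M $ p $ q * v $ q) * v $ p)"
      by (simp add: sum_distrib_right mult.assoc)
    also have "\<dots> = (\<Sum>i\<in>UNIV. \<Sum>k\<in>UNIV. M $ (i, i) $ (k, k))"
      by (simp only: sum_v)
    finally show ?thesis .
  qed
  have sym: "(qap_X0 :: real^('n \<times> 'n)^('n \<times> 'n)) \<in> sym_mats"
    by (simp add: sym_mats_def transpose_def vec_eq_iff X0 mult.commute)
  have "w \<bullet> (qap_X0 *v w) = (v \<bullet> w)\<^sup>2" for w :: "real^('n \<times> 'n)"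
    by (simp add: inner_vec_def matrix_vector_mult_def X0 power2_eq_square sum_product
        sum_distrib_left mult_ac)
  then have "(qap_X0 :: real^('n \<times> 'n)^('n \<times> 'n)) \<in> dnn_cone"
    using sym by (simp add: dnn_cone_def psd_cone_def entrywise_nonneg_def X0 v)
  moreover have "trace_inner (mat 1 \<otimes>\<^sub>K diag_unit j) qap_X0 = 1"
    "trace_inner (diag_unit j \<otimes>\<^sub>K mat 1) qap_X0 = 1" for j :: 'n
  proof -
    have "(\<Sum>i\<in>UNIV. \<Sum>k\<in>UNIV. (mat 1 \<otimes>\<^sub>K diag_unit j) $ (i, i) $ (k, k)) =
        (\<Sum>i\<in>UNIV. \<Sum>k\<in>UNIV. if k = j then if i = j then 1 else 0 else (0::real))"
      by (intro sum.cong refl) (auto simp: kron_def mat_def diag_unit_def)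
    then show "trace_inner (mat 1 \<otimes>\<^sub>K diag_unit j) qap_X0 = 1"
      unfolding X0_inner by simp
    have "(\<Sum>i\<in>UNIV. \<Sum>k\<in>UNIV. (diag_unit j \<otimes>\<^sub>K mat 1) $ (i, i) $ (k, k)) =
        (\<Sum>i\<in>UNIV. \<Sum>k\<in>UNIV. if k = j then if i = j then 1 else 0 else (0::real))"
      by (intro sum.cong refl) (auto simp: kron_def mat_def diag_unit_def)
    then show "trace_inner (diag_unit j \<otimes>\<^sub>K mat 1) qap_X0 = 1"
      unfolding X0_inner by simp
  qed
  moreover have "trace_inner (mat 1 \<otimes>\<^sub>K (all_ones - mat 1) + (all_ones - mat 1) \<otimes>\<^sub>K mat 1)
      (qap_X0 :: real^('n \<times> 'n)^('n \<times> 'n)) = 0"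
    unfolding X0_inner by (intro sum.neutral ballI) (simp add: kron_def mat_def all_ones_def)
  moreover have "trace_inner all_ones (qap_X0 :: real^('n \<times> 'n)^('n \<times> 'n)) = real (CARD('n)\<^sup>2)"
    unfolding X0_inner by (simp add: all_ones_def power2_eq_square)
  ultimately show ?thesis
    using sym by (auto simp: feasible_def affine_feasible_def qap_constraints_def)
qed

end

theory Submission
  imports Defs
begin

text \<open>Write \<open>P\<close> for the orthogonal projection onto \<open>S\<close>.

  \<^emph>\<open>Disjoint supports.\<close>  If \<open>P\<close> preserves entrywise nonnegativity, then \<open>S\<close> is closed under the
  entrywise positive part (\<open>pos_part_mem\<close>), and a finite-dimensional space of this kind has a basis of
  nonnegative elements with disjoint supports, namely those of minimal support
  (\<open>disjoint_nonneg_basis\<close>).  If instead the identity lies in \<open>S\<close>, the same preservation property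
  follows from that for the doubly nonnegative cone (\<open>nonneg_preserving_if_identity_mem\<close>):
  off the diagonal, positive semidefiniteness can be enforced by adding a multiple of the identity;
  on the diagonal, it is automatic for the matrix units that test the entries.

  \<^emph>\<open>Jordan configurations.\<close>  Admissibility puts the point of least norm of the affine constraint
  space into \<open>S\<close> (\<open>qap_centre_mem\<close>).  The unit \<open>e\<close> of \<open>S\<close> represents the trace on \<open>S\<close>, so
  \<open>e = P I\<close>, and this is entrywise nonnegative.  Its action on the zero pattern of the least-norm
  point then leaves only \<open>e = I\<close> (\<open>qap_unit_eq_identity\<close>).  Once \<open>S\<close> contains the identity and \<open>P\<close>
  preserves positive semidefiniteness, \<open>S\<close> is closed under squares (\<open>square_mem\<close>); this is the
  equality case of Kadison's inequality \<open>P(A\<^sup>2) \<ge> P(A)\<^sup>2\<close>, proved here through an orthonormal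
  eigenbasis of \<open>A\<close>.  Squaring produces the all-ones matrix (\<open>all_ones_mem\<close>), which turns the disjoint
  nonnegative basis into the characteristic matrices of a partition (\<open>jordan_configurationI\<close>).\<close>

section \<open>Orthogonal projections onto spaces of symmetric matrices\<close>

lemma orth_proj_residual:
  assumes "subspace S" "S \<subseteq> sym_mats" "Z \<in> S"
  shows "(X - orth_proj S X) \<bullet> Z = 0"
  using orth_proj(2)[OF assms] trace_inner_sym_mats assms by (metis subsetD)

lemma orth_proj_inner_eqI:
  assumes "subspace S" "S \<subseteq> sym_mats" "Y \<in> S" "\<And>Z. Z \<in> S \<Longrightarrow> (X - Y) \<bullet> Z = 0"
  shows "orth_proj S X = Y"
  using assms by (intro orth_proj_eqI) (auto simp: trace_inner_sym_mats subsetD)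

lemma orth_proj_id:
  assumes "subspace S" "S \<subseteq> sym_mats" "X \<in> S"
  shows "orth_proj S X = X"
  using assms by (intro orth_proj_inner_eqI) auto

lemma linear_orth_proj:
  assumes S: "subspace S" "S \<subseteq> sym_mats"
  shows "linear (orth_proj S)"
proof (rule linearI)
  note res = orth_proj_residual[OF S]
  fix X Y :: "real^'a^'a" and c :: real
  have "(X + Y - (orth_proj S X + orth_proj S Y)) \<bullet> Z = 0" if "Z \<in> S" for Z
    using res[OF that, of X] res[OF that, of Y] by (simp add: inner_simps)
  then show "orth_proj S (X + Y) = orth_proj S X + orth_proj S Y"
    using S by (intro orth_proj_inner_eqI) (auto simp: subspace_add orth_proj(1))
  have "(c *\<^sub>R X - c *\<^sub>R orth_proj S X) \<bullet> Z = 0" if "Z \<in> S" for Z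
    using res[OF that, of X] by (simp add: inner_simps)
  then show "orth_proj S (c *\<^sub>R X) = c *\<^sub>R orth_proj S X"
    using S by (intro orth_proj_inner_eqI) (auto simp: subspace_scale orth_proj(1))
qed

lemma orth_proj_self_adjoint:
  assumes S: "subspace S" "S \<subseteq> sym_mats"
  shows "orth_proj S X \<bullet> Y = X \<bullet> orth_proj S Y"
proof -
  have "(X - orth_proj S X) \<bullet> orth_proj S Y = 0" "(Y - orth_proj S Y) \<bullet> orth_proj S X = 0"
    by (intro orth_proj_residual[OF S] orth_proj(1)[OF S])+
  then show ?thesis
    by (simp add: inner_diff_left inner_commute[of "orth_proj S X"])
qed

text \<open>Writing \<open>P\<close> for the projection, \<open>X \<bullet> P X = (norm (P X))\<^sup>2 \<le> (norm X)\<^sup>2\<close>, and the inequality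
  is strict unless \<open>X\<close> lies in \<open>S\<close>.  Both the lattice property and the membership of the centre
  of the constraint space are obtained from this criterion.\<close>

lemma orth_proj_fixedI:
  assumes S: "subspace S" "S \<subseteq> sym_mats" and le: "X \<bullet> X \<le> X \<bullet> orth_proj S X"
  shows "orth_proj S X = X" and "X \<in> S"
proof -
  let ?Y = "orth_proj S X"
  have "?Y \<bullet> ?Y = X \<bullet> ?Y"
    using orth_proj_residual[OF S orth_proj(1)[OF S]] by (simp add: inner_diff_left)
  then have "(X - ?Y) \<bullet> (X - ?Y) \<le> 0"
    using le by (simp add: inner_simps inner_commute)
  then show *: "orth_proj S X = X"
    by (metis inner_gt_zero_iff not_le eq_iff_diff_eq_0)
  show "X \<in> S"
    using orth_proj(1)[OF S, of X] * by simp
qed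

lemma inner_matrix: "X \<bullet> Y = (\<Sum>i\<in>UNIV. \<Sum>j\<in>UNIV. X $ i $ j * Y $ i $ j)"
  for X Y :: "real^'k^'k"
  by (simp add: inner_vec_def)

section \<open>Subspaces closed under the entrywise positive part\<close>

definition pos_part :: "real^'k^'k \<Rightarrow> real^'k^'k" where
  "pos_part X = (\<chi> i j. max 0 (X $ i $ j))"

lemma nonneg_pos_part: "entrywise_nonneg (pos_part X)"
  by (simp add: entrywise_nonneg_def pos_part_def)

text \<open>A nonnegativity preserving projection is monotone and fixes \<open>X\<close> and \<open>0\<close>, so the projection of
  \<open>pos_part X\<close> dominates both, hence dominates \<open>pos_part X\<close>.  As it cannot be longer than
  \<open>pos_part X\<close>, the two are equal.\<close>

lemma pos_part_mem:
  assumes S: "subspace S" "S \<subseteq> sym_mats"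
    and P: "orth_proj S ` nonneg_cone \<subseteq> nonneg_cone" and X: "X \<in> S"
  shows "pos_part X \<in> S"
proof (rule orth_proj_fixedI(2)[OF S])
  let ?Q = "pos_part X"
  have sX: "X $ j $ i = X $ i $ j" for i j
    using S X by (auto simp: sym_mats_def transpose_def vec_eq_iff)
  have 1: "?Q \<in> nonneg_cone" "?Q - X \<in> nonneg_cone"
    by (auto simp: nonneg_cone_def sym_mats_def transpose_def vec_eq_iff pos_part_def
        entrywise_nonneg_def sX max_def)
  have "orth_proj S (?Q - X) = orth_proj S ?Q - X"
    using linear_diff[OF linear_orth_proj[OF S]] orth_proj_id[OF S X] by metis
  moreover have "orth_proj S ?Q \<in> nonneg_cone" "orth_proj S (?Q - X) \<in> nonneg_cone"
    using P 1 by blast+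
  ultimately have "0 \<le> orth_proj S ?Q $ i $ j" "X $ i $ j \<le> orth_proj S ?Q $ i $ j" for i j
    by (simp_all add: nonneg_cone_def entrywise_nonneg_def)
  then show "?Q \<bullet> ?Q \<le> ?Q \<bullet> orth_proj S ?Q"
    by (auto simp: inner_matrix pos_part_def intro!: sum_mono mult_left_mono)
qed

lemma pos_part_neg_part: "X = pos_part X - pos_part (- X)"
  by (auto simp: pos_part_def vec_eq_iff max_def)

text \<open>Subtracting the largest multiple of \<open>Y\<close> that leaves \<open>X\<close> nonnegative kills an entry.\<close>

lemma subtract_shrinks_supp:
  fixes X Y :: "real^'k^'k"
  assumes X: "entrywise_nonneg X" and Y: "entrywise_nonneg Y" "Y \<noteq> 0" and sub: "supp Y \<subseteq> supp X"
  obtains t where "entrywise_nonneg (X - t *\<^sub>R Y)" "supp (X - t *\<^sub>R Y) \<subset> supp X"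
proof -
  define r where "r = (\<lambda>(i, j). X $ i $ j / Y $ i $ j)"
  define t where "t = Min (r ` supp Y)"
  have fin: "finite (supp Y)" by simp
  have ne: "supp Y \<noteq> {}"
    using Y by (auto simp: supp_def vec_eq_iff)
  have t: "t \<in> r ` supp Y" "\<And>p. p \<in> supp Y \<Longrightarrow> t \<le> r p"
    using fin ne by (auto simp: t_def)
  then obtain a b where ab: "(a, b) \<in> supp Y" "t = X $ a $ b / Y $ a $ b"
    by (auto simp: r_def)
  have le: "t * Y $ i $ j \<le> X $ i $ j" for i j
  proof (cases "Y $ i $ j = 0")
    case False
    then have "Y $ i $ j > 0" "t \<le> X $ i $ j / Y $ i $ j"
      using Y(1) t(2)[of "(i, j)"] by (auto simp: entrywise_nonneg_def supp_def r_def less_le)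
    then show ?thesis by (simp add: field_simps)
  qed (use X in \<open>auto simp: entrywise_nonneg_def\<close>)
  have "Y $ i $ j = 0" if "X $ i $ j = 0" for i j
    using sub that by (auto simp: supp_def)
  then have "supp (X - t *\<^sub>R Y) \<subseteq> supp X"
    by (auto simp: supp_def)
  moreover have "(a, b) \<in> supp X" "(a, b) \<notin> supp (X - t *\<^sub>R Y)"
    using ab sub by (auto simp: supp_def)
  ultimately have "supp (X - t *\<^sub>R Y) \<subset> supp X" by blast
  then show ?thesis
    using le by (intro that[of t]) (auto simp: entrywise_nonneg_def)
qed

text \<open>The basis consists of one representative for each minimal support of a nonzero nonnegative
  element.  Two different minimal supports are disjoint because the entrywise minimum of the
  representatives lives on their intersection, and peeling off representatives shows that they span
  all nonnegative elements.\<close>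

lemma disjoint_nonneg_basis:
  fixes S :: "(real^'k^'k) set"
  assumes S: "subspace S" and pos: "\<And>X. X \<in> S \<Longrightarrow> pos_part X \<in> S"
  obtains \<B> where "independent \<B>" "span \<B> = S" "\<And>X. X \<in> \<B> \<Longrightarrow> entrywise_nonneg X"
    "pairwise (\<lambda>X Y. disjnt (supp X) (supp Y)) \<B>"
proof -
  define C where "C = {X \<in> S. entrywise_nonneg X \<and> X \<noteq> 0}"
  define M where "M = {T \<in> supp ` C. \<forall>Z \<in> C. supp Z \<subseteq> T \<longrightarrow> supp Z = T}"
  define f where "f T = (SOME Y. Y \<in> C \<and> supp Y = T)" for T
  have f: "f T \<in> C" "supp (f T) = T" if "T \<in> M" for T
    using that someI_ex[of "\<lambda>Y. Y \<in> C \<and> supp Y = T"] by (auto simp: M_def f_def)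
  have BS: "f ` M \<subseteq> S"
    using f(1) by (auto simp: C_def)
  have disj: "T \<inter> U = {}" if "T \<in> M" "U \<in> M" "T \<noteq> U" for T U
  proof (rule ccontr)
    assume ne: "T \<inter> U \<noteq> {}"
    \<comment> \<open>The entrywise minimum of the two representatives.\<close>
    define W where "W = f T - pos_part (f T - f U)"
    have W: "W $ i $ j = min (f T $ i $ j) (f U $ i $ j)" for i j
      by (auto simp: W_def pos_part_def)
    have nn: "f T $ i $ j \<ge> 0" "f U $ i $ j \<ge> 0" for i j
      using f(1)[OF that(1)] f(1)[OF that(2)] by (auto simp: C_def entrywise_nonneg_def)
    have "W $ i $ j \<noteq> 0 \<longleftrightarrow> f T $ i $ j \<noteq> 0 \<and> f U $ i $ j \<noteq> 0" for i j
      using nn[of i j] by (auto simp: W min_def)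
    then have sW: "supp W = supp (f T) \<inter> supp (f U)"
      by (auto simp: supp_def)
    moreover have "W \<in> S"
      unfolding W_def using S pos f(1) that by (auto simp: C_def intro!: subspace_diff)
    moreover have "W \<noteq> 0"
      using ne sW f(2) that by (auto simp: supp_def)
    ultimately have "W \<in> C" "supp W \<subseteq> T" "supp W \<subseteq> U"
      using nn f(2) that by (auto simp: C_def entrywise_nonneg_def W)
    then have "supp W = T" "supp W = U"
      using that(1,2) by (simp_all add: M_def)
    then show False
      using that(3) by simp
  qed
  have span_nonneg: "X \<in> span (f ` M)" if "X \<in> S" "entrywise_nonneg X" for X
    using that
  proof (induction "card (supp X)" arbitrary: X rule: less_induct)
    case less
    show ?case
    proof (cases "X = 0")
      case False
      define D where "D = {Y \<in> C. supp Y \<subseteq> supp X}"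
      have "X \<in> D"
        using less.prems False by (auto simp: D_def C_def)
      then obtain Y where Y: "Y \<in> D" and Ymin: "\<And>Z. Z \<in> D \<Longrightarrow> card (supp Y) \<le> card (supp Z)"
        using ex_has_least_nat[of "\<lambda>Y. Y \<in> D" X "\<lambda>Y. card (supp Y)"] by auto
      have "supp Z = supp Y" if "Z \<in> C" "supp Z \<subseteq> supp Y" for Z
        using Ymin[of Z] that Y by (intro card_seteq) (auto simp: D_def)
      then have YM: "supp Y \<in> M"
        using Y by (auto simp: M_def D_def)
      define V where "V = f (supp Y)"
      have V: "V \<in> C" "supp V \<subseteq> supp X" "V \<in> f ` M"
        using f[OF YM] YM Y by (auto simp: V_def D_def)
      then obtain t where t: "entrywise_nonneg (X - t *\<^sub>R V)" "supp (X - t *\<^sub>R V) \<subset> supp X"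
        using subtract_shrinks_supp[of X V] less.prems by (auto simp: C_def)
      have "X - t *\<^sub>R V \<in> span (f ` M)"
        using t V S less.prems
        by (intro less.hyps psubset_card_mono) (auto simp: C_def subspace_diff subspace_scale)
      then have "(X - t *\<^sub>R V) + t *\<^sub>R V \<in> span (f ` M)"
        using V by (intro span_add) (auto intro: span_scale span_base)
      then show ?thesis by simp
    qed (simp add: span_zero)
  qed
  have "pos_part X \<in> span (f ` M)" "pos_part (- X) \<in> span (f ` M)" if "X \<in> S" for X
    using that S by (auto intro!: span_nonneg pos nonneg_pos_part subspace_neg)
  then have "X \<in> span (f ` M)" if "X \<in> S" for X
    using that by (subst pos_part_neg_part) (simp add: span_diff)
  then have "span (f ` M) = S"
    using S BS span_minimal by blast
  moreover have "pairwise (\<lambda>X Y. disjnt (supp X) (supp Y)) (f ` M)"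
    unfolding pairwise_image using f(2) disj by (auto simp: pairwise_def disjnt_def)
  moreover have "independent (f ` M)"
  proof (rule pairwise_orthogonal_independent)
    have "X \<bullet> Y = 0" if "disjnt (supp X) (supp Y)" for X Y :: "real^'k^'k"
      unfolding inner_matrix using that
      by (intro sum.neutral ballI) (auto simp: disjnt_def supp_def)
    then show "pairwise orthogonal (f ` M)"
      using calculation(2) by (auto simp: pairwise_def orthogonal_def)
    show "0 \<notin> f ` M"
      using f(1) by (auto simp: C_def)
  qed
  moreover have "entrywise_nonneg X" if "X \<in> f ` M" for X
    using that f(1) by (auto simp: C_def)
  ultimately show ?thesis
    using that by blast
qed

section \<open>Spaces containing the identity matrix\<close>

lemma add_identity_psd:
  fixes X :: "real^'k^'k"
  assumes "X \<in> sym_mats"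
  obtains t where "0 \<le> t" "X + t *\<^sub>R mat 1 \<in> psd_cone"
proof -
  let ?t = "onorm ((*v) X)"
  have bl: "bounded_linear ((*v) X)" by simp
  have "0 \<le> v \<bullet> ((X + ?t *\<^sub>R mat 1) *v v)" for v
  proof -
    have "\<bar>v \<bullet> (X *v v)\<bar> \<le> norm v * (?t * norm v)"
      using Cauchy_Schwarz_ineq2[of v "X *v v"] onorm[OF bl, of v]
      by (meson mult_left_mono norm_ge_zero order_trans)
    also have "\<dots> = ?t * (v \<bullet> v)"
      by (simp add: power2_norm_eq_inner[symmetric] power2_eq_square)
    finally show ?thesis
      by (simp add: matrix_vector_mult_add_rdistrib scaleR_matrix_vector_assoc[symmetric]
          inner_simps)
  qed
  moreover have "X + ?t *\<^sub>R mat 1 \<in> sym_mats"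
    using assms by (auto simp: sym_mats_def transpose_def vec_eq_iff mat_def)
  ultimately show ?thesis
    using onorm_pos_le[OF bl] that[of ?t] by (simp add: psd_cone_def)
qed

lemma inner_diag_unit: "X \<bullet> diag_unit l = X $ l $ l"
proof -
  have "X \<bullet> diag_unit l = (\<Sum>i\<in>UNIV. if i = l then X $ l $ l else 0)"
    unfolding inner_matrix by (intro sum.cong) (auto simp: diag_unit_def if_distrib cong: if_cong)
  then show ?thesis by simp
qed

lemma sum_diag_unit: "(\<Sum>l\<in>UNIV. diag_unit l) = mat 1"
proof -
  have "(\<Sum>l\<in>UNIV. diag_unit l) $ i $ j = mat 1 $ i $ j" for i j :: 'a
  proof -
    have "(\<Sum>l\<in>UNIV. diag_unit l) $ i $ j = (\<Sum>l\<in>UNIV. if l = i then mat 1 $ i $ j else (0::real))"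
      unfolding sum_component by (intro sum.cong) (auto simp: diag_unit_def mat_def)
    then show ?thesis by simp
  qed
  then show ?thesis by (simp add: vec_eq_iff)
qed

lemma diag_unit_dnn: "diag_unit l \<in> dnn_cone"
proof -
  have "diag_unit l *v v = v $ l *\<^sub>R axis l 1" for v :: "real^'a"
    by (auto simp: vec_eq_iff matrix_vector_mult_def diag_unit_def axis_def if_distrib[where f = "\<lambda>x. x * _"]
        cong: if_cong)
  then have "0 \<le> v \<bullet> (diag_unit l *v v)" for v :: "real^'a"
    by (simp add: inner_axis)
  moreover have "diag_unit l \<in> sym_mats" "entrywise_nonneg (diag_unit l)"
    by (auto simp: sym_mats_def entrywise_nonneg_def transpose_def vec_eq_iff diag_unit_def)
  ultimately show ?thesis
    by (simp add: dnn_cone_def psd_cone_def)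
qed

text \<open>Adding a large multiple of the identity makes a nonnegative symmetric matrix doubly nonnegative,
  and the projection leaves that summand alone, so the off-diagonal entries of \<open>orth_proj S X\<close> are
  nonnegative.  The diagonal entries are inner products of \<open>X\<close> with the projections of the doubly
  nonnegative matrices \<open>diag_unit i\<close>.\<close>

lemma nonneg_preserving_if_identity_mem:
  fixes S :: "(real^'k^'k) set"
  assumes S: "subspace S" "S \<subseteq> sym_mats" and P: "orth_proj S ` dnn_cone \<subseteq> dnn_cone"
    and I: "mat 1 \<in> S"
  shows "orth_proj S ` nonneg_cone \<subseteq> nonneg_cone"
proof (rule image_subsetI)
  let ?P = "orth_proj S"
  fix X :: "real^'k^'k" assume "X \<in> nonneg_cone"
  then have X: "X \<in> sym_mats" "entrywise_nonneg X" by (auto simp: nonneg_cone_def)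
  have lin: "linear ?P" by (rule linear_orth_proj[OF S])
  have Q: "0 \<le> ?P (diag_unit l) $ i $ j" for l i j
    using P diag_unit_dnn[of l] by (auto simp: image_subset_iff dnn_cone_def entrywise_nonneg_def)
  have "0 \<le> ?P X $ i $ j" for i j
  proof (cases "i = j")
    case True
    have "?P X $ i $ i = X \<bullet> ?P (diag_unit i)"
      using orth_proj_self_adjoint[OF S] inner_diag_unit by metis
    moreover have "0 \<le> X \<bullet> ?P (diag_unit i)"
      unfolding inner_matrix using X(2) Q
      by (auto intro!: sum_nonneg mult_nonneg_nonneg simp: entrywise_nonneg_def)
    ultimately show ?thesis
      using True by simp
  next
    case False
    obtain t where t: "0 \<le> t" "X + t *\<^sub>R mat 1 \<in> psd_cone"
      using add_identity_psd[OF X(1)] .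
    then have "X + t *\<^sub>R mat 1 \<in> dnn_cone"
      using X(2) by (auto simp: dnn_cone_def entrywise_nonneg_def mat_def)
    then have "0 \<le> ?P (X + t *\<^sub>R mat 1) $ i $ j"
      using P by (auto simp: image_subset_iff dnn_cone_def entrywise_nonneg_def)
    also have "?P (X + t *\<^sub>R mat 1) = ?P X + t *\<^sub>R mat 1"
      using orth_proj_id[OF S I] by (simp add: linear_add[OF lin] linear_cmul[OF lin])
    finally show ?thesis
      using False by (simp add: mat_def)
  qed
  then show "?P X \<in> nonneg_cone"
    using orth_proj(1)[OF S, of X] S(2) by (auto simp: nonneg_cone_def entrywise_nonneg_def)
qed

section \<open>The spectral theorem\<close>

lemma sym_mats_inner:
  assumes "A \<in> sym_mats"
  shows "v \<bullet> (A *v w) = (A *v v) \<bullet> w"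
  using assms dot_lmul_matrix[of v A w] transpose_matrix_vector[of A v] by (simp add: sym_mats_def)

text \<open>A form that is nonnegative on \<open>V\<close> and vanishes at \<open>v\<close> attains its minimum there, so its
  gradient at \<open>v\<close> vanishes along \<open>V\<close>.\<close>

lemma psd_form_kernel:
  fixes M :: "real^'k^'k"
  assumes M: "M \<in> sym_mats" and V: "subspace V" "v \<in> V" "w \<in> V"
    and nn: "\<And>u. u \<in> V \<Longrightarrow> 0 \<le> u \<bullet> (M *v u)" and 0: "v \<bullet> (M *v v) = 0"
  shows "w \<bullet> (M *v v) = 0"
proof (rule ccontr)
  assume ne: "w \<bullet> (M *v v) \<noteq> 0"
  define b c where "b = w \<bullet> (M *v v)" and "c = w \<bullet> (M *v w)"
  have sym: "v \<bullet> (M *v w) = b"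
    using sym_mats_inner[OF M] by (simp add: b_def inner_commute)
  have poly: "0 \<le> 2 * s * b + s\<^sup>2 * c" for s
  proof -
    have "0 \<le> (v + s *\<^sub>R w) \<bullet> (M *v (v + s *\<^sub>R w))"
      using V by (intro nn) (simp add: subspace_add subspace_scale)
    also have "\<dots> = 2 * s * b + s\<^sup>2 * c"
      using 0 sym by (simp add: matrix_vector_right_distrib matrix_vector_mult_scaleR inner_add_left
          inner_add_right b_def c_def power2_eq_square algebra_simps)
    finally show ?thesis .
  qed
  have "0 \<le> c"
    using nn[OF V(3)] by (simp add: c_def)
  \<comment> \<open>At this \<open>s\<close> the linear term beats the quadratic one.\<close>
  define s where "s = - b / (c + 1)"
  have "2 * s * b + s\<^sup>2 * c = - (b\<^sup>2 * (c + 2)) / (c + 1)\<^sup>2"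
    using \<open>0 \<le> c\<close> by (simp add: s_def power2_eq_square divide_simps) (simp add: algebra_simps)
  also have "\<dots> < 0"
    using ne \<open>0 \<le> c\<close> by (simp add: b_def divide_neg_pos)
  finally show False
    using poly[of s] by simp
qed

text \<open>A maximiser of the Rayleigh quotient on the unit sphere of \<open>V\<close> is an eigenvector.\<close>

lemma symmetric_eigenvector:
  fixes A :: "real^'k^'k"
  assumes A: "A \<in> sym_mats" and V: "subspace V" "V \<noteq> {0}"
    and inv: "\<And>v. v \<in> V \<Longrightarrow> A *v v \<in> V"
  obtains v c where "v \<in> V" "norm v = 1" "A *v v = c *\<^sub>R v"
proof -
  let ?K = "sphere 0 1 \<inter> V"
  obtain u where "u \<in> V" "u \<noteq> 0"
    using V subspace_0 by blast
  then have "u /\<^sub>R norm u \<in> ?K"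
    using V by (simp add: subspace_scale)
  then have "?K \<noteq> {}" by blast
  moreover have "compact ?K"
    using V by (intro compact_Int_closed closed_subspace) auto
  moreover have "continuous_on ?K (\<lambda>u. u \<bullet> (A *v u))"
    by (intro continuous_intros linear_continuous_on) auto
  ultimately obtain v where v: "v \<in> ?K" and max: "\<And>u. u \<in> ?K \<Longrightarrow> u \<bullet> (A *v u) \<le> v \<bullet> (A *v v)"
    using continuous_attains_sup[of ?K "\<lambda>u. u \<bullet> (A *v u)"] by metis
  define c where "c = v \<bullet> (A *v v)"
  define M where "M = c *\<^sub>R mat 1 - A"
  have Mv: "M *v u = c *\<^sub>R u - A *v u" for u
    by (simp add: M_def matrix_vector_mult_diff_rdistrib scaleR_matrix_vector_assoc[symmetric])
  have M: "M \<in> sym_mats"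
    using A by (auto simp: M_def sym_mats_def transpose_def vec_eq_iff mat_def)
  have nn: "0 \<le> u \<bullet> (M *v u)" if "u \<in> V" for u
  proof (cases "u = 0")
    case False
    then have "u /\<^sub>R norm u \<in> ?K"
      using that V by (simp add: subspace_scale)
    then have "(u /\<^sub>R norm u) \<bullet> (A *v (u /\<^sub>R norm u)) \<le> c"
      using max unfolding c_def by blast
    then have "u \<bullet> (A *v u) / norm u / norm u \<le> c"
      by (simp only: matrix_vector_mult_scaleR inner_scaleR_left inner_scaleR_right divide_inverse
          mult.commute[of "inverse _"])
    then have "u \<bullet> (A *v u) / (norm u)\<^sup>2 \<le> c"
      by (simp add: power2_eq_square)
    then show ?thesis
      using False by (simp add: Mv inner_diff_right power2_norm_eq_inner pos_divide_le_eq)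
  qed simp
  have vv: "v \<in> V" "norm v = 1"
    using v by auto
  then have "v \<bullet> v = 1"
    by (simp add: dot_square_norm)
  then have "v \<bullet> (M *v v) = 0"
    by (simp add: Mv inner_diff_right c_def)
  moreover have "M *v v \<in> V"
    unfolding Mv using inv vv V by (simp add: subspace_diff subspace_scale)
  ultimately have "(M *v v) \<bullet> (M *v v) = 0"
    using psd_form_kernel[OF M V(1)] vv nn by blast
  then have "A *v v = c *\<^sub>R v"
    by (simp add: Mv)
  with vv show ?thesis
    using that by blast
qed

lemma orthonormal_eigenbasis_on:
  fixes A :: "real^'k^'k"
  assumes A: "A \<in> sym_mats" and "subspace V" and "\<And>v. v \<in> V \<Longrightarrow> A *v v \<in> V"
  shows "\<exists>B \<subseteq> V. pairwise orthogonal B \<and> (\<forall>v \<in> B. norm v = 1 \<and> (\<exists>c. A *v v = c *\<^sub>R v)) \<and>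
    finite B \<and> span B = V"
  using assms(2,3)
proof (induction "dim V" arbitrary: V rule: less_induct)
  case less
  show ?case
  proof (cases "V = {0}")
    case False
    obtain v c where v: "v \<in> V" "norm v = 1" "A *v v = c *\<^sub>R v"
      using symmetric_eigenvector[OF A less.prems(1) False less.prems(2)] by metis
    then have v1: "v \<bullet> v = 1"
      by (simp add: dot_square_norm)
    define W where "W = {w \<in> V. v \<bullet> w = 0}"
    have W: "subspace W" "W \<subseteq> V"
      using less.prems(1) by (auto simp: W_def subspace_def inner_add_right)
    have "v \<notin> W"
      using v1 by (simp add: W_def)
    then have "dim W < dim V"
      using W v less.prems(1) by (intro dim_psubset) (simp add: span_eq_iff[THEN iffD2] psubset_eq, blast)
    moreover have "A *v w \<in> W" if "w \<in> W" for w
      using that less.prems(2) sym_mats_inner[OF A, of v w] v by (simp add: W_def)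
    ultimately obtain B where B: "B \<subseteq> W" "pairwise orthogonal B"
      "\<forall>v \<in> B. norm v = 1 \<and> (\<exists>c. A *v v = c *\<^sub>R v)" "finite B" "span B = W"
      using less.hyps[OF _ W(1)] by metis
    have "u \<in> span (insert v B)" if "u \<in> V" for u
    proof -
      have "u - (v \<bullet> u) *\<^sub>R v \<in> W"
        using that v v1 less.prems(1) by (simp add: W_def subspace_diff subspace_scale inner_diff_right)
      then show ?thesis
        using B(5) by (auto simp: span_insert)
    qed
    moreover have "span (insert v B) \<subseteq> V"
      using B(1) W v less.prems(1) by (intro span_minimal) auto
    moreover have "pairwise orthogonal (insert v B)"
      using B(1,2) by (auto simp: pairwise_insert W_def orthogonal_def inner_commute)
    ultimately show ?thesis
      using B v W by (intro exI[of _ "insert v B"]) auto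
  qed (auto intro: exI[of _ "{}"])
qed

lemma orthonormal_eigenbasis:
  fixes A :: "real^'k^'k"
  assumes "A \<in> sym_mats"
  obtains B where "pairwise orthogonal B" "finite B" "span B = UNIV"
    "\<And>v. v \<in> B \<Longrightarrow> norm v = 1" "\<And>v. v \<in> B \<Longrightarrow> \<exists>c. A *v v = c *\<^sub>R v"
  using orthonormal_eigenbasis_on[OF assms subspace_UNIV] by (metis UNIV_I)

lemma trace_orthonormal_basis:
  fixes M :: "real^'k^'k"
  assumes B: "pairwise orthogonal B" "\<And>v. v \<in> B \<Longrightarrow> norm v = 1" "finite B" "span B = UNIV"
  shows "(\<Sum>v\<in>B. v \<bullet> (M *v v)) = M \<bullet> mat 1"
proof -
  have "(\<Sum>v\<in>B. v $ j * v $ i) = (if i = j then 1 else 0)" for i j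
  proof -
    have "(\<Sum>v\<in>B. (axis j 1 \<bullet> v) *\<^sub>R v) = axis j 1"
      using B by (intro orthonormal_basis_expand) auto
    then have "(\<Sum>v\<in>B. (axis j 1 \<bullet> v) *\<^sub>R v) $ i = axis j 1 $ i"
      by simp
    then show ?thesis
      by (simp add: inner_axis') (simp add: axis_def)
  qed
  note * = this
  have "(\<Sum>v\<in>B. v \<bullet> (M *v v)) = (\<Sum>v\<in>B. \<Sum>i\<in>UNIV. \<Sum>j\<in>UNIV. M $ i $ j * (v $ j * v $ i))"
    by (simp add: inner_vec_def matrix_vector_mult_def sum_distrib_left mult_ac)
  also have "\<dots> = (\<Sum>i\<in>UNIV. \<Sum>j\<in>UNIV. M $ i $ j * (\<Sum>v\<in>B. v $ j * v $ i))"
    by (simp add: sum_distrib_left sum.swap[of _ UNIV B])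
  also have "\<dots> = M \<bullet> mat 1"
    by (simp add: * inner_matrix mat_def)
  finally show ?thesis .
qed

lemma matrix_add_rdistrib: "(A + B) ** C = A ** C + B ** C" for A :: "real^'l^'m"
  by (simp add: matrix_matrix_mult_def vec_eq_iff distrib_right sum.distrib)

lemma matrix_diff_ldistrib: "A ** (B - C) = A ** B - A ** C" for A :: "real^'l^'m"
  by (simp add: matrix_matrix_mult_def vec_eq_iff right_diff_distrib sum_subtractf)

lemma matrix_diff_rdistrib: "(A - B) ** C = A ** C - B ** C" for A :: "real^'l^'m"
  by (simp add: matrix_matrix_mult_def vec_eq_iff left_diff_distrib sum_subtractf)

section \<open>Projections that preserve positive semidefiniteness\<close>

lemma square_psd:
  assumes "M \<in> sym_mats"
  shows "M ** M \<in> psd_cone"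
proof -
  have "v \<bullet> ((M ** M) *v v) = (M *v v) \<bullet> (M *v v)" for v
    by (simp only: matrix_vector_mul_assoc[symmetric] sym_mats_inner[OF assms, of v "M *v v"])
  then show ?thesis
    using assms by (simp add: psd_cone_def sym_mats_def matrix_transpose_mul)
qed

text \<open>Let \<open>v\<close> run through an orthonormal eigenbasis of \<open>A\<close>, with eigenvalue \<open>c\<close>.  Projecting the
  positive semidefinite matrix \<open>(A - c I)\<^sup>2\<close> gives \<open>N = P(A\<^sup>2) - 2 c A + c\<^sup>2 I\<close>, so \<open>v \<bullet> N v \<ge> 0\<close>
  says that \<open>v \<bullet> P(A\<^sup>2) v \<ge> c\<^sup>2\<close>.  Summing over the basis yields \<open>trace P(A\<^sup>2) \<ge> trace A\<^sup>2\<close>, where in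
  fact equality holds, as the projection preserves the trace because of \<open>I \<in> S\<close>.  Hence \<open>v \<bullet> N v = 0\<close> throughout,
  which forces \<open>N v = 0\<close>, that is \<open>P(A\<^sup>2) v = c\<^sup>2 v = A\<^sup>2 v\<close>.\<close>

lemma square_mem:
  fixes S :: "(real^'k^'k) set"
  assumes S: "subspace S" "S \<subseteq> sym_mats" and P: "orth_proj S ` psd_cone \<subseteq> psd_cone"
    and I: "mat 1 \<in> S" and A: "A \<in> S"
  shows "A ** A \<in> S"
proof -
  let ?P = "orth_proj S"
  let ?Q = "?P (A ** A)"
  have lin: "linear ?P" by (rule linear_orth_proj[OF S])
  have As: "A \<in> sym_mats" using A S by blast
  obtain B where B: "pairwise orthogonal B" "finite B" "span B = UNIV"
    "\<And>v. v \<in> B \<Longrightarrow> norm v = 1" and eig: "\<And>v. v \<in> B \<Longrightarrow> \<exists>c. A *v v = c *\<^sub>R v"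
    using orthonormal_eigenbasis[OF As] by metis
  define N where "N c = ?Q - (2 * c) *\<^sub>R A + c\<^sup>2 *\<^sub>R mat 1" for c
  have Npsd: "N c \<in> psd_cone" for c
  proof -
    let ?D = "A - c *\<^sub>R mat 1"
    have "?D \<in> sym_mats"
      using As by (auto simp: sym_mats_def transpose_def vec_eq_iff mat_def)
    then have "?P (?D ** ?D) \<in> psd_cone"
      using P square_psd by blast
    also have "?D ** ?D = A ** A - c *\<^sub>R A - (c *\<^sub>R A - c\<^sup>2 *\<^sub>R mat 1)"
      by (simp only: matrix_diff_ldistrib matrix_diff_rdistrib scalar_matrix_assoc[symmetric]
          matrix_scalar_ac matrix_mul_lid matrix_mul_rid scaleR_diff_right scaleR_scaleR
          power2_eq_square)
    also have "\<dots> = A ** A - (2 * c) *\<^sub>R A + c\<^sup>2 *\<^sub>R mat 1"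
      by (simp only: mult_2 scaleR_add_left diff_conv_add_uminus minus_add_distrib minus_minus
          add_ac)
    also have "?P \<dots> = N c"
      by (simp add: N_def linear_add[OF lin] linear_diff[OF lin] linear_cmul[OF lin]
          orth_proj_id[OF S] A I)
    finally show ?thesis .
  qed
  have Nv: "N c *v v = ?Q *v v - (A ** A) *v v" if "A *v v = c *\<^sub>R v" for c v
  proof -
    have "N c *v v = ?Q *v v - (2 * c) *\<^sub>R (c *\<^sub>R v) + c\<^sup>2 *\<^sub>R v"
      using that by (simp add: N_def matrix_vector_mult_diff_rdistrib
          matrix_vector_mult_add_rdistrib scaleR_matrix_vector_assoc[symmetric])
    also have "\<dots> = ?Q *v v - c *\<^sub>R (c *\<^sub>R v)"
      by (simp only: mult_2 distrib_right scaleR_add_left scaleR_scaleR power2_eq_square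
          diff_add_eq_diff_diff_swap diff_add_cancel)
    also have "c *\<^sub>R (c *\<^sub>R v) = (A ** A) *v v"
      using that by (simp add: matrix_vector_mul_assoc[symmetric] matrix_vector_mult_scaleR)
    finally show ?thesis .
  qed
  have nn: "0 \<le> v \<bullet> ((?Q - A ** A) *v v)" if v: "v \<in> B" for v
  proof -
    obtain c where c: "A *v v = c *\<^sub>R v"
      using eig[OF v] by blast
    have "0 \<le> v \<bullet> (N c *v v)"
      using Npsd by (simp add: psd_cone_def)
    then show ?thesis
      by (simp add: Nv[OF c] matrix_vector_mult_diff_rdistrib)
  qed
  have "?Q \<bullet> mat 1 = (A ** A) \<bullet> mat 1"
    using orth_proj_self_adjoint[OF S, of "A ** A" "mat 1"] orth_proj_id[OF S I] by simp
  then have "(\<Sum>v\<in>B. v \<bullet> ((?Q - A ** A) *v v)) = 0"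
    using trace_orthonormal_basis[OF B(1,4,2,3)] by (simp add: inner_diff_left)
  then have 0: "v \<bullet> ((?Q - A ** A) *v v) = 0" if "v \<in> B" for v
    using nn that B(2) by (simp add: sum_nonneg_eq_0_iff)
  have "?Q *v v = (A ** A) *v v" if v: "v \<in> B" for v
  proof -
    obtain c where c: "A *v v = c *\<^sub>R v"
      using eig[OF v] by blast
    have "v \<bullet> (N c *v v) = 0"
      using 0[OF v] by (simp add: Nv[OF c] matrix_vector_mult_diff_rdistrib)
    then have "(N c *v v) \<bullet> (N c *v v) = 0"
      using psd_form_kernel[OF _ subspace_UNIV, of "N c" v] Npsd[of c]
      by (simp add: psd_cone_def)
    then show ?thesis
      using Nv[OF c] by simp
  qed
  note on_basis = this
  have "?Q *v v = (A ** A) *v v" for v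
    by (rule linear_eq_on[OF matrix_vector_mul_linear matrix_vector_mul_linear, of v B])
      (simp_all only: B(3) UNIV_I on_basis)
  then have "?Q = A ** A"
    by (simp add: matrix_eq)
  then show ?thesis
    using orth_proj(1)[OF S, of "A ** A"] by simp
qed

lemma anticommutator_mem:
  fixes S :: "(real^'k^'k) set"
  assumes S: "subspace S" and sq: "\<And>A. A \<in> S \<Longrightarrow> A ** A \<in> S" and XY: "X \<in> S" "Y \<in> S"
  shows "X ** Y + Y ** X \<in> S"
proof -
  have "X ** Y + Y ** X = (X + Y) ** (X + Y) - X ** X - Y ** Y"
    by (simp add: matrix_add_ldistrib matrix_add_rdistrib)
  then show ?thesis
    using S sq XY by (simp add: subspace_add subspace_diff)
qed

text \<open>Both sides represent the trace on \<open>S\<close>, since the trace of the Jordan product of \<open>e\<close> and \<open>Z\<close> is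
  that of \<open>e ** Z\<close>.\<close>

lemma unit_eq_orth_proj_identity:
  fixes S :: "(real^'k^'k) set"
  assumes S: "subspace S" "S \<subseteq> sym_mats" and e: "e \<in> S" "\<And>a. a \<in> S \<Longrightarrow> jordan_prod e a = a"
  shows "orth_proj S (mat 1) = e"
proof (rule orth_proj_eqI[OF S e(1)])
  fix Z assume "Z \<in> S"
  then have "trace (jordan_prod e Z) = trace Z"
    using e(2) by simp
  moreover have "trace (jordan_prod e Z) = trace (e ** Z)"
    unfolding jordan_prod_def using trace_mul_sym[of e Z]
    by (simp add: trace_def sum.distrib sum_divide_distrib[symmetric])
  ultimately show "trace_inner (mat 1 - e) Z = 0"
    by (simp add: trace_inner_def matrix_diff_rdistrib trace_sub)
qed

section \<open>Kronecker products\<close>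

lemma kron_nth: "(X \<otimes>\<^sub>K Y) $ p $ q = X $ fst p $ fst q * Y $ snd p $ snd q"
  by (simp add: kron_def)

lemma kron_add_left: "(X + X') \<otimes>\<^sub>K Y = X \<otimes>\<^sub>K Y + X' \<otimes>\<^sub>K Y"
  and kron_add_right: "X \<otimes>\<^sub>K (Y + Y') = X \<otimes>\<^sub>K Y + X \<otimes>\<^sub>K Y'"
  and kron_scaleR_left: "(c *\<^sub>R X) \<otimes>\<^sub>K Y = c *\<^sub>R (X \<otimes>\<^sub>K Y)"
  and kron_scaleR_right: "X \<otimes>\<^sub>K (c *\<^sub>R Y) = c *\<^sub>R (X \<otimes>\<^sub>K Y)"
  by (simp_all add: vec_eq_iff kron_nth algebra_simps)

lemma kron_sum_right: "X \<otimes>\<^sub>K (\<Sum>l\<in>L. Y l) = (\<Sum>l\<in>L. X \<otimes>\<^sub>K Y l)"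
  by (simp add: vec_eq_iff kron_nth sum_distrib_left)

lemma sum_prod_UNIV:
  "(\<Sum>p\<in>UNIV. f (fst p) * g (snd p)) = (\<Sum>i\<in>UNIV. f i) * (\<Sum>j\<in>UNIV. g j :: real)"
  by (simp add: sum_product sum.cartesian_product split_def)

lemma kron_mult:
  fixes X X' :: "real^'a^'a" and Y Y' :: "real^'b^'b"
  shows "(X \<otimes>\<^sub>K Y) ** (X' \<otimes>\<^sub>K Y') = (X ** X') \<otimes>\<^sub>K (Y ** Y')"
proof -
  have "((X \<otimes>\<^sub>K Y) ** (X' \<otimes>\<^sub>K Y')) $ p $ q = ((X ** X') \<otimes>\<^sub>K (Y ** Y')) $ p $ q" for p q
    using sum_prod_UNIV[of "\<lambda>i. X $ fst p $ i * X' $ i $ fst q"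
        "\<lambda>j. Y $ snd p $ j * Y' $ j $ snd q"]
    by (simp add: matrix_matrix_mult_def kron_nth mult_ac)
  then show ?thesis by (simp add: vec_eq_iff)
qed

lemma trace_kron: "trace (X \<otimes>\<^sub>K Y) = trace X * trace Y"
  using sum_prod_UNIV[of "\<lambda>i. X $ i $ i" "\<lambda>j. Y $ j $ j"] by (simp add: trace_def kron_nth)

lemma trace_inner_kron:
  "trace_inner (X \<otimes>\<^sub>K Y) (X' \<otimes>\<^sub>K Y') = trace_inner X X' * trace_inner Y Y'"
  by (simp add: trace_inner_def kron_mult trace_kron)

lemma trace_inner_add_left: "trace_inner (X + Y) Z = trace_inner X Z + trace_inner Y Z"
  and trace_inner_add_right: "trace_inner Z (X + Y) = trace_inner Z X + trace_inner Z Y"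
  and trace_inner_scaleR_right: "trace_inner Z (c *\<^sub>R X) = c * trace_inner Z X"
  by (simp_all add: trace_inner_def trace_def matrix_matrix_mult_def sum.distrib distrib_left
      distrib_right sum_distrib_left mult_ac)

section \<open>The centre of the affine constraint space\<close>

definition off_ones :: "real^'k^'k" where
  "off_ones = all_ones - mat 1"

lemma off_ones_nth: "off_ones $ i $ j = (if i = j then 0 else 1)"
  by (simp add: off_ones_def all_ones_def mat_def)

lemma off_ones_square:
  "(off_ones :: real^'k^'k) ** off_ones
     = (real CARD('k) - 2) *\<^sub>R off_ones + (real CARD('k) - 1) *\<^sub>R mat 1"
proof -
  have "((off_ones :: real^'k^'k) ** off_ones) $ i $ j
      = ((real CARD('k) - 2) *\<^sub>R off_ones + (real CARD('k) - 1) *\<^sub>R mat 1 :: real^'k^'k) $ i $ j"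
    for i j
  proof -
    have "((off_ones :: real^'k^'k) ** off_ones) $ i $ j
        = (\<Sum>l\<in>UNIV. (if i = l then - 1 else 0) + (if j = l then (if i = j then 0 else - 1) else 0) + 1)"
      unfolding matrix_matrix_mult_def vec_lambda_beta
      by (intro sum.cong) (auto simp: off_ones_nth)
    then show ?thesis
      by (simp add: sum.distrib off_ones_nth mat_def)
  qed
  then show ?thesis by (simp add: vec_eq_iff)
qed

lemma trace_inner_blocks:
  "trace_inner (mat 1) (mat 1 :: real^'k^'k) = real CARD('k)"
  "trace_inner (mat 1) (off_ones :: real^'k^'k) = 0"
  "trace_inner off_ones (mat 1 :: real^'k^'k) = 0"
  "trace_inner off_ones (off_ones :: real^'k^'k) = real CARD('k) * (real CARD('k) - 1)"
  "trace_inner (diag_unit l) (mat 1 :: real^'k^'k) = 1"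
  "trace_inner (diag_unit l) (off_ones :: real^'k^'k) = 0"
proof -
  have tr: "trace (off_ones :: real^'k^'k) = 0"
    by (simp add: trace_def off_ones_nth)
  show "trace_inner (mat 1) (mat 1 :: real^'k^'k) = real CARD('k)"
    "trace_inner (mat 1) (off_ones :: real^'k^'k) = 0"
    "trace_inner off_ones (mat 1 :: real^'k^'k) = 0"
    by (simp_all add: trace_inner_def trace_I tr)
  show "trace_inner off_ones (off_ones :: real^'k^'k) = real CARD('k) * (real CARD('k) - 1)"
    unfolding trace_inner_def off_ones_square
    by (simp add: trace_def off_ones_nth mat_def)
  have sym: "(mat 1 :: real^'k^'k) \<in> sym_mats" "(off_ones :: real^'k^'k) \<in> sym_mats"
    by (auto simp: sym_mats_def transpose_def vec_eq_iff mat_def off_ones_nth)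
  moreover have "(mat 1 :: real^'k^'k) $ l $ l = 1"
    by (simp add: mat_def)
  ultimately show "trace_inner (diag_unit l) (mat 1 :: real^'k^'k) = 1"
    "trace_inner (diag_unit l) (off_ones :: real^'k^'k) = 0"
    by (simp_all add: trace_inner_sym_mats inner_commute[of "diag_unit l"] inner_diag_unit
        off_ones_nth)
qed

text \<open>This is the point of least norm in the affine constraint space: it satisfies the constraints
  and is orthogonal to the solutions of the homogeneous constraints.  It takes one value on the
  diagonal, another one on the pairs of indices that differ in both coordinates, and is zero
  elsewhere, where the zero constraint forces all nonnegative feasible matrices to vanish.\<close>

definition qap_centre :: "real^('n::finite \<times> 'n)^('n \<times> 'n)" where
  "qap_centre = (1 / real CARD('n)) *\<^sub>R
     (mat 1 \<otimes>\<^sub>K mat 1 + (1 / (real CARD('n) - 1)) *\<^sub>R (off_ones \<otimes>\<^sub>K off_ones))"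

lemma kron_mat_1: "mat 1 \<otimes>\<^sub>K mat 1 = mat 1"
  by (auto simp: vec_eq_iff kron_nth mat_def prod_eq_iff)

lemma all_ones_kron: "all_ones \<otimes>\<^sub>K all_ones = all_ones"
  by (simp add: vec_eq_iff kron_nth all_ones_def)

lemma all_ones_split: "all_ones = mat 1 + off_ones"
  by (simp add: off_ones_def)

lemma qap_centre_sym: "qap_centre \<in> sym_mats"
  by (auto simp: sym_mats_def transpose_def vec_eq_iff qap_centre_def kron_nth mat_def off_ones_nth)

lemma qap_centre_feasible:
  assumes n: "CARD('n) > 1"
  shows "(qap_centre :: real^('n::finite \<times> 'n)^('n \<times> 'n)) \<in> affine_feasible qap_constraints"
proof -
  note simps = qap_centre_def trace_inner_scaleR_right trace_inner_add_left trace_inner_add_right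
    trace_inner_kron trace_inner_blocks
  have "trace_inner (mat 1 \<otimes>\<^sub>K diag_unit j) (qap_centre :: real^('n \<times> 'n)^('n \<times> 'n)) = 1"
    "trace_inner (diag_unit j \<otimes>\<^sub>K mat 1) (qap_centre :: real^('n \<times> 'n)^('n \<times> 'n)) = 1" for j :: 'n
    by (simp_all add: simps)
  moreover have "trace_inner (mat 1 \<otimes>\<^sub>K off_ones + off_ones \<otimes>\<^sub>K mat 1)
      (qap_centre :: real^('n \<times> 'n)^('n \<times> 'n)) = 0"
    by (simp add: simps)
  moreover have "trace_inner all_ones (qap_centre :: real^('n \<times> 'n)^('n \<times> 'n)) = real (CARD('n)\<^sup>2)"
  proof -
    have t: "trace_inner all_ones (mat 1 :: real^'n^'n) = CARD('n)"
      "trace_inner all_ones (off_ones :: real^'n^'n) = CARD('n) * (real CARD('n) - 1)"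
      by (simp_all add: all_ones_split trace_inner_add_left trace_inner_blocks)
    let ?n = "real CARD('n)"
    have "trace_inner (all_ones \<otimes>\<^sub>K all_ones) (qap_centre :: real^('n \<times> 'n)^('n \<times> 'n))
        = 1 / ?n * (?n * ?n + 1 / (?n - 1) * ((?n * (?n - 1)) * (?n * (?n - 1))))"
      by (simp only: simps t)
    also have "\<dots> = ?n\<^sup>2"
      using n by (simp add: field_simps power2_eq_square)
    finally show ?thesis
      by (simp add: all_ones_kron)
  qed
  ultimately show ?thesis
    using qap_centre_sym by (auto simp: affine_feasible_def qap_constraints_def off_ones_def)
qed

text \<open>The centre is a combination of constraint matrices: the matrices \<open>mat 1 \<otimes>\<^sub>K diag_unit j\<close> sum
  to the identity, and the all-ones matrix minus the identity and minus the matrix of the zero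
  constraint is \<open>off_ones \<otimes>\<^sub>K off_ones\<close>.\<close>

lemma qap_centre_orthogonal:
  assumes Z: "Z \<in> constr_space (qap_constraints :: ((real^('n::finite \<times> 'n)^('n \<times> 'n)) \<times> real) set)"
  shows "qap_centre \<bullet> Z = 0"
proof -
  let ?N = "mat 1 \<otimes>\<^sub>K off_ones + off_ones \<otimes>\<^sub>K mat 1 :: real^('n \<times> 'n)^('n \<times> 'n)"
  let ?R = "off_ones \<otimes>\<^sub>K off_ones :: real^('n \<times> 'n)^('n \<times> 'n)"
  have Zs: "Z \<in> sym_mats" and zero: "\<And>j. trace_inner (mat 1 \<otimes>\<^sub>K diag_unit j) Z = 0"
    "trace_inner ?N Z = 0" "trace_inner all_ones Z = 0"
    using Z by (auto simp: constr_space_def qap_constraints_def off_ones_def)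
  have tr: "trace_inner M Z = M \<bullet> Z" for M
    using Zs by (rule trace_inner_sym_mats)
  have "(mat 1 \<otimes>\<^sub>K mat 1) \<bullet> Z = (\<Sum>j\<in>UNIV. (mat 1 \<otimes>\<^sub>K diag_unit j) \<bullet> Z)"
    by (simp add: inner_sum_left[symmetric] kron_sum_right[symmetric] sum_diag_unit)
  then have I: "(mat 1 \<otimes>\<^sub>K mat 1) \<bullet> Z = 0"
    using zero(1) by (simp add: tr)
  have J: "all_ones = mat 1 \<otimes>\<^sub>K mat 1 + ?N + ?R"
    unfolding all_ones_kron[symmetric] all_ones_split by (simp add: kron_add_left kron_add_right)
  have "all_ones \<bullet> Z = (mat 1 \<otimes>\<^sub>K mat 1) \<bullet> Z + ?N \<bullet> Z + ?R \<bullet> Z"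
    by (simp only: J inner_add_left)
  then have "?R \<bullet> Z = 0"
    using zero(2,3) I by (simp add: tr)
  then show ?thesis
    using I by (simp add: qap_centre_def inner_add_left)
qed

text \<open>The projection moves the centre inside the affine constraint space, hence orthogonally to the
  centre; so the projected centre has the same inner product with the centre as the centre itself.\<close>

lemma qap_centre_mem:
  fixes S :: "(real^('n::finite \<times> 'n)^('n \<times> 'n)) set"
  assumes n: "CARD('n) > 1" and S: "subspace S" "S \<subseteq> sym_mats"
    and feas: "orth_proj S ` ((+) qap_X0 ` constr_space qap_constraints)
      \<subseteq> (+) qap_X0 ` constr_space qap_constraints"
  shows "qap_centre \<in> S"
proof (rule orth_proj_fixedI(2)[OF S])
  let ?X = "qap_centre :: real^('n \<times> 'n)^('n \<times> 'n)"
  have aff: "(+) qap_X0 ` constr_space qap_constraints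
      = (+) ?X ` constr_space (qap_constraints :: ((real^('n \<times> 'n)^('n \<times> 'n)) \<times> real) set)"
    using affine_feasible_eq_translate[OF qap_centre_feasible[OF n]]
      affine_feasible_eq_translate[OF IntD1[OF qap_X0_feasible[unfolded feasible_def]]]
    by (rule trans[OF sym, rotated])
  have "?X \<in> (+) ?X ` constr_space qap_constraints"
    using affine_feasible_eq_translate[OF qap_centre_feasible[OF n]] qap_centre_feasible[OF n] by simp
  then have "orth_proj S ?X \<in> (+) ?X ` constr_space qap_constraints"
    using feas unfolding aff by blast
  then obtain Z where "Z \<in> constr_space qap_constraints" "orth_proj S ?X = ?X + Z"
    by blast
  then show "?X \<bullet> ?X \<le> ?X \<bullet> orth_proj S ?X"
    by (simp add: inner_add_right qap_centre_orthogonal)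
qed

section \<open>The unit is the identity matrix\<close>

lemma qap_centre_nth:
  assumes "CARD('n) > 1"
  shows "(qap_centre :: real^('n::finite \<times> 'n)^('n \<times> 'n)) $ p $ p > 0"
    and "0 \<le> (qap_centre :: real^('n \<times> 'n)^('n \<times> 'n)) $ p $ q"
    and "(qap_centre :: real^('n \<times> 'n)^('n \<times> 'n)) $ p $ q = 0
      \<longleftrightarrow> p \<noteq> q \<and> (fst p = fst q \<or> snd p = snd q)"
  using assms by (auto simp: qap_centre_def kron_nth mat_def off_ones_nth prod_eq_iff)

text \<open>In \<open>e X + X e = 2 X\<close> all entries are nonnegative, so a zero \<open>(p, r)\<close> of the centre \<open>X\<close> forces every term of
  \<open>(e X)\<^sub>p\<^sub>r\<close> to vanish, so that \<open>e\<close> is zero at \<open>(p, q)\<close> as soon as some \<open>r\<close> has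
  \<open>X\<^sub>p\<^sub>r = 0\<close> and \<open>X\<^sub>q\<^sub>r \<noteq> 0\<close>.  Such an \<open>r\<close> exists for any \<open>p \<noteq> q\<close>: if \<open>p\<close> and \<open>q\<close> share a
  coordinate, take \<open>r = q\<close>; otherwise \<open>r\<close> shares its first coordinate with \<open>p\<close>, while its second
  one is a third value, different from those of \<open>p\<close> and \<open>q\<close>.  Hence \<open>e\<close> is diagonal, and the
  positive diagonal of \<open>X\<close> shows that its diagonal entries are \<open>1\<close>.\<close>

lemma qap_unit_eq_identity:
  fixes e :: "real^('n::finite \<times> 'n)^('n \<times> 'n)"
  assumes n: "CARD('n) > 2" and e: "entrywise_nonneg e"
    and unit: "jordan_prod e qap_centre = qap_centre"
  shows "e = mat 1"
proof -
  let ?X = "qap_centre :: real^('n \<times> 'n)^('n \<times> 'n)"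
  have n1: "CARD('n) > 1" using n by simp
  note X = qap_centre_nth[OF n1]
  have enn: "0 \<le> e $ p $ q" for p q
    using e unfolding entrywise_nonneg_def by blast
  have nn: "0 \<le> e $ p $ q * ?X $ q $ r" "0 \<le> ?X $ p $ q * e $ q $ r" for p q r
    using enn X(2) by simp_all
  have eX: "(e ** ?X) $ p $ r + (?X ** e) $ p $ r = 2 * ?X $ p $ r" for p r
  proof -
    have "jordan_prod e ?X $ p $ r = ?X $ p $ r"
      by (simp only: unit)
    then show ?thesis
      by (simp add: jordan_prod_def)
  qed
  have zero: "e $ p $ q = 0" if "?X $ p $ r = 0" "?X $ q $ r \<noteq> 0" for p q r
  proof -
    have "0 \<le> (\<Sum>q\<in>UNIV. e $ p $ q * ?X $ q $ r)" "0 \<le> (\<Sum>q\<in>UNIV. ?X $ p $ q * e $ q $ r)"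
      by (intro sum_nonneg nn)+
    then have "(\<Sum>q\<in>UNIV. e $ p $ q * ?X $ q $ r) = 0"
      using eX[of p r] that(1) by (simp add: matrix_matrix_mult_def)
    then have "e $ p $ q * ?X $ q $ r = 0"
      by (intro sum_nonneg_0[where f = "\<lambda>q. e $ p $ q * ?X $ q $ r"] nn) auto
    then show ?thesis
      using that(2) by simp
  qed
  have off: "e $ p $ q = 0" if pq: "p \<noteq> q" for p q
  proof (cases "fst p = fst q \<or> snd p = snd q")
    case True
    then show ?thesis
      using zero[of p q q] X(3)[of p q] X(1)[of q] pq by simp
  next
    case False
    have "card {snd p, snd q} \<le> 2"
      by (simp add: card_insert_if)
    then have "{snd p, snd q} \<noteq> UNIV"
      using n by (metis not_le)
    then obtain l where l: "l \<noteq> snd p" "l \<noteq> snd q"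
      by blast
    have "?X $ p $ (fst p, l) = 0" "?X $ q $ (fst p, l) \<noteq> 0"
      using False l X(3) by (auto simp: prod_eq_iff)
    then show ?thesis
      by (rule zero)
  qed
  have "e $ p $ p = 1" for p
  proof -
    have "(\<Sum>q\<in>UNIV. e $ p $ q * ?X $ q $ p) = (\<Sum>q\<in>UNIV. if q = p then e $ p $ p * ?X $ p $ p else 0)"
      "(\<Sum>q\<in>UNIV. ?X $ p $ q * e $ q $ p) = (\<Sum>q\<in>UNIV. if q = p then e $ p $ p * ?X $ p $ p else 0)"
      by (intro sum.cong; force simp: off)+
    then have "e $ p $ p * ?X $ p $ p = ?X $ p $ p"
      using eX[of p p] by (simp add: matrix_matrix_mult_def)
    then show ?thesis
      using X(1)[of p] by simp
  qed
  with off show ?thesis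
    by (simp add: vec_eq_iff mat_def)
qed

section \<open>The all-ones matrix\<close>

text \<open>With \<open>K = off_ones\<close>, the matrices \<open>I\<close>, \<open>R = K \<otimes>\<^sub>K K\<close> and \<open>N = I \<otimes>\<^sub>K K + K \<otimes>\<^sub>K I\<close> add up to the
  all-ones matrix.  The centre and the identity provide \<open>R\<close>, and
  \<open>K\<^sup>2 = (n - 2) K + (n - 1) I\<close> makes \<open>N\<close> appear in \<open>R\<^sup>2\<close> with the coefficient
  \<open>(n - 2) (n - 1)\<close>, which is nonzero for \<open>n > 2\<close>.\<close>

lemma all_ones_mem:
  fixes S :: "(real^('n::finite \<times> 'n)^('n \<times> 'n)) set"
  assumes n: "CARD('n) > 2" and S: "subspace S" and I: "mat 1 \<in> S" and X: "qap_centre \<in> S"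
    and sq: "\<And>A. A \<in> S \<Longrightarrow> A ** A \<in> S"
  shows "all_ones \<in> S"
proof -
  let ?n = "real CARD('n)"
  let ?I = "mat 1 \<otimes>\<^sub>K mat 1 :: real^('n \<times> 'n)^('n \<times> 'n)"
  let ?R = "off_ones \<otimes>\<^sub>K off_ones :: real^('n \<times> 'n)^('n \<times> 'n)"
  let ?N = "mat 1 \<otimes>\<^sub>K off_ones + off_ones \<otimes>\<^sub>K mat 1 :: real^('n \<times> 'n)^('n \<times> 'n)"
  have I': "?I \<in> S"
    using I by (simp add: kron_mat_1)
  have "(?n - 1) *\<^sub>R (?n *\<^sub>R qap_centre - ?I) = ?R"
    using n by (simp add: qap_centre_def)
  then have R: "?R \<in> S"
    using S I' X by (metis subspace_scale subspace_diff)
  define a b where "a = ?n - 2" and "b = ?n - 1"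
  have ab: "a * b \<noteq> 0"
    using n by (simp add: a_def b_def)
  have "?R ** ?R = (a *\<^sub>R off_ones + b *\<^sub>R mat 1) \<otimes>\<^sub>K (a *\<^sub>R off_ones + b *\<^sub>R mat 1)"
    by (simp add: kron_mult off_ones_square a_def b_def)
  also have "\<dots> = (a * a) *\<^sub>R ?R + (a * b) *\<^sub>R ?N + (b * b) *\<^sub>R ?I"
    by (simp add: kron_add_left kron_add_right kron_scaleR_left kron_scaleR_right algebra_simps)
  finally have "(1 / (a * b)) *\<^sub>R (?R ** ?R - (a * a) *\<^sub>R ?R - (b * b) *\<^sub>R ?I) = ?N"
    using ab by simp
  moreover have "(1 / (a * b)) *\<^sub>R (?R ** ?R - (a * a) *\<^sub>R ?R - (b * b) *\<^sub>R ?I) \<in> S"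
    by (intro subspace_scale subspace_diff S sq R I')
  ultimately have "?N \<in> S" by simp
  then have "?I + ?N + ?R \<in> S"
    by (intro subspace_add[OF S subspace_add[OF S I'] R])
  also have "?I + ?N + ?R = all_ones"
    unfolding all_ones_kron[symmetric] all_ones_split by (simp add: kron_add_left kron_add_right)
  finally show ?thesis .
qed

section \<open>From disjoint bases to partitions\<close>

lemma span_disjoint_coeffs:
  fixes \<B> :: "(real^'k^'k) set"
  assumes disj: "pairwise (\<lambda>X Y. disjnt (supp X) (supp Y)) \<B>" and "finite \<B>"
    and Z: "Z \<in> span \<B>"
  obtains c where "\<And>X i j. X \<in> \<B> \<Longrightarrow> (i, j) \<in> supp X \<Longrightarrow> Z $ i $ j = c X * X $ i $ j"
    "\<And>i j. (i, j) \<notin> \<Union> (supp ` \<B>) \<Longrightarrow> Z $ i $ j = 0"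
proof -
  obtain c where c: "Z = (\<Sum>X\<in>\<B>. c X *\<^sub>R X)"
    using Z span_finite[OF \<open>finite \<B>\<close>] by auto
  then have Zij: "Z $ i $ j = (\<Sum>X\<in>\<B>. c X * X $ i $ j)" for i j
    by simp
  have "Z $ i $ j = c X * X $ i $ j" if "X \<in> \<B>" "(i, j) \<in> supp X" for X i j
  proof -
    have "Y $ i $ j = 0" if "Y \<in> \<B>" "Y \<noteq> X" for Y
      using pairwiseD[OF disj \<open>Y \<in> \<B>\<close> \<open>X \<in> \<B>\<close> \<open>Y \<noteq> X\<close>] \<open>(i, j) \<in> supp X\<close>
      by (auto simp: disjnt_def supp_def)
    then have "(\<Sum>Y\<in>\<B>. c Y * Y $ i $ j) = (\<Sum>Y\<in>\<B>. if Y = X then c X * X $ i $ j else 0)"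
      by (intro sum.cong) auto
    then show ?thesis
      using that(1) \<open>finite \<B>\<close> by (simp add: Zij)
  qed
  moreover have "Z $ i $ j = 0" if "(i, j) \<notin> \<Union> (supp ` \<B>)" for i j
    unfolding Zij using that by (intro sum.neutral) (auto simp: supp_def)
  ultimately show ?thesis
    using that by blast
qed

text \<open>The coefficients of the all-ones matrix rescale the basis elements to the characteristic
  matrices of their supports, and show that the supports cover all positions.\<close>

lemma jordan_configurationI:
  fixes S :: "(real^'k^'k) set"
  assumes S: "subspace S" "S \<subseteq> sym_mats" and I: "mat 1 \<in> S" and J: "all_ones \<in> S"
    and sq: "\<And>A. A \<in> S \<Longrightarrow> A ** A \<in> S"
    and B: "independent \<B>" "span \<B> = S" and disj: "pairwise (\<lambda>X Y. disjnt (supp X) (supp Y)) \<B>"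
  shows "jordan_configuration S"
proof -
  have fin: "finite \<B>"
    using B(1) by (rule independent_imp_finite)
  have "all_ones \<in> span \<B>" using J B(2) by simp
  then obtain c where c': "\<And>X i j. X \<in> \<B> \<Longrightarrow> (i, j) \<in> supp X \<Longrightarrow> all_ones $ i $ j = c X * X $ i $ j"
    and cover': "\<And>i j. (i, j) \<notin> \<Union> (supp ` \<B>) \<Longrightarrow> all_ones $ i $ j = (0::real)"
    using span_disjoint_coeffs[OF disj fin] by blast
  have J1: "all_ones $ i $ j = (1::real)" for i j :: 'k
    by (simp add: all_ones_def)
  have c: "1 = c X * X $ i $ j" if "X \<in> \<B>" "(i, j) \<in> supp X" for X i j
    using c'[OF that] by (simp only: J1)
  have cover: "(i, j) \<in> \<Union> (supp ` \<B>)" for i j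
    using cover'[of i j] J1[of i j] by fastforce
  have "X \<noteq> 0" if "X \<in> \<B>" for X
    using that B(1) dependent_zero by blast
  then have ne: "supp X \<noteq> {}" if "X \<in> \<B>" for X
    using that by (auto simp: supp_def vec_eq_iff)
  have char: "char_mat (supp X) = c X *\<^sub>R X" if "X \<in> \<B>" for X
    using c[OF that] by (auto simp: vec_eq_iff char_mat_def supp_def)
  have c0: "c X \<noteq> 0" if "X \<in> \<B>" for X
    using c[OF that] ne[OF that] by fastforce
  let ?P = "supp ` \<B>"
  have part: "partition_on UNIV ?P"
  proof (rule partition_onI)
    show "\<Union> ?P = UNIV" using cover by auto
    show "disjnt p q" if "p \<in> ?P" "q \<in> ?P" "p \<noteq> q" for p q
      using that disj by (auto simp: pairwise_def)
    show "{} \<notin> ?P"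
      using ne by force
  qed
  have "char_mat ` ?P \<subseteq> span \<B>"
    by (simp add: image_subset_iff char span_scale span_base)
  moreover have "\<B> \<subseteq> span (char_mat ` ?P)"
  proof
    fix X assume X: "X \<in> \<B>"
    have "(1 / c X) *\<^sub>R char_mat (supp X) \<in> span (char_mat ` ?P)"
      using X by (intro span_scale span_base) auto
    then show "X \<in> span (char_mat ` ?P)"
      using char[OF X] c0[OF X] by simp
  qed
  ultimately have span: "span (char_mat ` ?P) = S"
    unfolding B(2)[symmetric] by (intro subset_antisym span_minimal subspace_span)
  then have sub: "char_mat ` ?P \<subseteq> S"
    using span_superset[of "char_mat ` ?P"] by (simp only:)
  have "X ** Y + Y ** X \<in> span (char_mat ` ?P)"
    if "X \<in> char_mat ` ?P" "Y \<in> char_mat ` ?P" for X Y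
  proof -
    note XY = subsetD[OF sub that(1)] subsetD[OF sub that(2)]
    show ?thesis
      unfolding span by (intro anticommutator_mem[OF S(1)] sq XY)
  qed
  moreover have "transpose X = X" if "X \<in> char_mat ` ?P" for X
    using sub S(2) that by (auto simp: sym_mats_def)
  ultimately have "jordan_partition ?P"
    using part I span by (simp add: jordan_partition_def)
  then show ?thesis
    using span unfolding jordan_configuration_def by blast
qed

theorem theorem4p1:
  fixes A B :: "real^'n^'n" and S :: "(real^('n \<times> 'n)^('n \<times> 'n)) set"
  assumes "CARD('n) > 2"
    and "A \<in> sym_mats" and "B \<in> sym_mats"
    and "admissible qap_constraints qap_X0 (qap_cost A B) S"
  shows "(mat 1 \<in> S \<or> orth_proj S ` nonneg_cone \<subseteq> nonneg_cone \<longrightarrow>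
            (\<exists>\<B>. independent \<B> \<and> span \<B> = S \<and>
                 (\<forall>X \<in> \<B>. entrywise_nonneg X) \<and>
                 pairwise (\<lambda>X Y. disjnt (supp X) (supp Y)) \<B>)) \<and>
         (orth_proj S ` psd_cone \<subseteq> psd_cone \<and> unital S \<longrightarrow> jordan_configuration S)"
proof -
  have S: "subspace S" "S \<subseteq> sym_mats" and dnn: "orth_proj S ` dnn_cone \<subseteq> dnn_cone"
    and feas: "orth_proj S ` ((+) qap_X0 ` constr_space qap_constraints)
      \<subseteq> (+) qap_X0 ` constr_space qap_constraints"
    using assms(4) by (auto simp: admissible_def)
  have basis: "\<exists>\<B>. independent \<B> \<and> span \<B> = S \<and> (\<forall>X \<in> \<B>. entrywise_nonneg X) \<and>
      pairwise (\<lambda>X Y. disjnt (supp X) (supp Y)) \<B>"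
    if "mat 1 \<in> S \<or> orth_proj S ` nonneg_cone \<subseteq> nonneg_cone"
  proof -
    have "orth_proj S ` nonneg_cone \<subseteq> nonneg_cone"
      using that nonneg_preserving_if_identity_mem[OF S dnn] by blast
    then show ?thesis
      using disjoint_nonneg_basis[OF S(1) pos_part_mem[OF S]] by metis
  qed
  moreover have "jordan_configuration S" if psd: "orth_proj S ` psd_cone \<subseteq> psd_cone" and "unital S"
  proof -
    obtain e where e: "e \<in> S" "\<And>a. a \<in> S \<Longrightarrow> jordan_prod e a = a"
      using \<open>unital S\<close> by (auto simp: unital_def)
    have centre: "qap_centre \<in> S"
      using qap_centre_mem[OF _ S feas] assms(1) by simp
    have "mat 1 \<in> dnn_cone"
      using square_psd[of "mat 1"]
      by (simp add: dnn_cone_def sym_mats_def entrywise_nonneg_def) (simp add: mat_def)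
    then have "entrywise_nonneg e"
      using dnn unit_eq_orth_proj_identity[OF S e] by (auto simp: dnn_cone_def)
    then have I: "mat 1 \<in> S"
      using qap_unit_eq_identity[OF assms(1) _ e(2)[OF centre]] e(1) by simp
    note sq = square_mem[OF S psd I]
    obtain \<B> where "independent \<B>" "span \<B> = S" "pairwise (\<lambda>X Y. disjnt (supp X) (supp Y)) \<B>"
      using basis I by blast
    then show ?thesis
      using jordan_configurationI[OF S I all_ones_mem[OF assms(1) S(1) I centre sq] sq] by blast
  qed
  ultimately show ?thesis by blast
qed

end
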